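(* Let $S$ be a signed star $K_{1,m+n}$ having $m$ positive edges and $n$ negative edges. Then $S$ is a parity signed graph if and only if $n=m$, or $n=m+2$, or $n=m+1$.
   Context: A signed graph is a pair $S=(G,\sigma)$ with $G$ a graph and $\sigma:E(G)\to\{+,-\}$. For a graph $G$ with $N$ vertices and a bijection $f:V(G)\to\{1,\dots,N\}$, define $\sigma_f(uv)=+$ if $f(u),f(v)$ have the same parity and $\sigma_f(uv)=-$ otherwise. $S$ is a parity signed graph (has a parity labelling) if $\sigma=\sigma_f$ for some such bijection $f$. *)

theory Defs
  imports Main
begin

record 'a graph =
  verts :: "'a set"
  edges :: "'a set set"

text \<open>Finite simple undirected graphs; an edge $uv$ is the two-element set \<open>{u, v}\<close>.\<close>

definition simple_graph :: "'a graph \<Rightarrow> bool" where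
  "simple_graph G \<longleftrightarrow> finite (verts G) \<and> (\<forall>e\<in>edges G. e \<subseteq> verts G \<and> card e = 2)"

definition complete_bipartite :: "nat \<Rightarrow> nat \<Rightarrow> 'a graph \<Rightarrow> bool" where
  "complete_bipartite p q G \<longleftrightarrow>
     (\<exists>A B. finite A \<and> finite B \<and> card A = p \<and> card B = q \<and> A \<inter> B = {} \<and>
            verts G = A \<union> B \<and> edges G = {{a, b} | a b. a \<in> A \<and> b \<in> B})"

datatype sign = Pos | Neg

text \<open>The signature is a total function on sets of vertices; only its values on the edges of the
  graph are ever used.\<close>

record 'a signed_graph = "'a graph" +
  signature :: "'a set \<Rightarrow> sign"

definition signed_graph :: "'a signed_graph \<Rightarrow> bool" where
  "signed_graph S \<longleftrightarrow> simple_graph (graph.truncate S)"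

definition edges_of_sign :: "'a signed_graph \<Rightarrow> sign \<Rightarrow> 'a set set" where
  "edges_of_sign S s = {e \<in> edges S. signature S e = s}"

definition parity_signature :: "('a \<Rightarrow> nat) \<Rightarrow> 'a set \<Rightarrow> sign" where
  "parity_signature f e = (if \<forall>u\<in>e. \<forall>v\<in>e. even (f u) = even (f v) then Pos else Neg)"

lemma parity_signature_edge:
  "parity_signature f {u, v} = (if even (f u) = even (f v) then Pos else Neg)"
  by (auto simp: parity_signature_def)

definition parity_labelling :: "'a signed_graph \<Rightarrow> ('a \<Rightarrow> nat) \<Rightarrow> bool" where
  "parity_labelling S f \<longleftrightarrow>
     bij_betw f (verts S) {1..card (verts S)} \<and>
     (\<forall>e\<in>edges S. signature S e = parity_signature f e)"

definition parity_signed_graph :: "'a signed_graph \<Rightarrow> bool" where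
  "parity_signed_graph S \<longleftrightarrow> signed_graph S \<and> (\<exists>f. parity_labelling S f)"

lemma complete_bipartite_simple_graph:
  "complete_bipartite p q G \<Longrightarrow> simple_graph G"
  unfolding complete_bipartite_def simple_graph_def by (fastforce simp: card_insert_if)

end

theory Submission
  imports Defs
begin

text \<open>The centre together with the ends of the positive edges must form exactly one parity class
  of the labels \<open>1, \<dots>, m + n + 1\<close>. This set has \<open>m + 1\<close> vertices, while the parity classes have
  \<open>\<lfloor>(m + n + 1) / 2\<rfloor>\<close> and \<open>\<lceil>(m + n + 1) / 2\<rceil>\<close> elements; conversely any set of vertices of one of
  these sizes is the preimage of a parity class under some bijective labelling.\<close>

lemma card_parity_class:
  "card {i \<in> {1..N}. even i = b} = (if b then N div 2 else (N + 1) div 2)"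
proof (induction N)
  case 0
  then show ?case by auto
next
  case (Suc N)
  have "{i \<in> {1..Suc N}. even i = b} =
      (if even (Suc N) = b then insert (Suc N) {i \<in> {1..N}. even i = b}
       else {i \<in> {1..N}. even i = b})"
    by (auto simp: le_Suc_eq)
  then have "card {i \<in> {1..Suc N}. even i = b} =
      (if even (Suc N) = b then 1 else 0) + card {i \<in> {1..N}. even i = b}"
    by simp
  with Suc show ?case
    by (cases b) (simp; presburger)+
qed

lemma parity_class_labelling_iff:
  assumes "finite V" "P \<subseteq> V"
  shows "(\<exists>f b. bij_betw f V {1..card V} \<and> (\<forall>v\<in>V. even (f v) = b \<longleftrightarrow> v \<in> P)) \<longleftrightarrow>
    card P = card V div 2 \<or> card P = (card V + 1) div 2"
    (is "?L \<longleftrightarrow> ?R")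
proof
  assume ?L
  then obtain f b where f: "bij_betw f V {1..card V}" "\<forall>v\<in>V. even (f v) = b \<longleftrightarrow> v \<in> P"
    by blast
  have "f ` P = {i \<in> {1..card V}. even i = b}"
    using f(2) assms(2) unfolding bij_betw_imp_surj_on[OF f(1), symmetric] by blast
  moreover have "inj_on f P"
    using f(1) assms(2) by (auto simp: bij_betw_def intro: inj_on_subset)
  ultimately have "card P = card {i \<in> {1..card V}. even i = b}"
    by (metis card_image)
  then show ?R
    unfolding card_parity_class by (simp split: if_splits)
next
  assume ?R
  then obtain b where b: "card P = card {i \<in> {1..card V}. even i = b}"
    unfolding card_parity_class by (metis (full_types))
  define I where "I = {i \<in> {1..card V}. even i = b}"
  define J where "J = {1..card V} - I"
  have IJ: "I \<union> J = {1..card V}" "I \<inter> J = {}" "finite I" "finite J"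
    by (auto simp: I_def J_def)
  have I: "card P = card I" using b by (simp only: I_def)
  have fin: "finite P" "finite (V - P)" using assms by (auto intro: finite_subset)
  have "card I + card J = card V"
    using card_Un_disjoint[OF IJ(3,4,2)] IJ(1) by simp
  then have J: "card (V - P) = card J"
    using I assms fin by (simp add: card_Diff_subset)
  obtain g where g: "bij_betw g P I"
    using finite_same_card_bij[OF fin(1) IJ(3) I] by blast
  obtain h where h: "bij_betw h (V - P) J"
    using finite_same_card_bij[OF fin(2) IJ(4) J] by blast
  define f where "f v = (if v \<in> P then g v else h v)" for v
  have "bij_betw f P I"
    using g by (rule iffD1[OF bij_betw_cong, rotated]) (simp add: f_def)
  moreover have "bij_betw f (V - P) J"
    using h by (rule iffD1[OF bij_betw_cong, rotated]) (simp add: f_def)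
  ultimately have "bij_betw f (P \<union> (V - P)) (I \<union> J)"
    using IJ(2) by (rule bij_betw_combine)
  then have "bij_betw f V {1..card V}"
    using assms(2) IJ(1) by (simp add: Un_absorb1)
  moreover have "even (f v) = b \<longleftrightarrow> v \<in> P" if "v \<in> V" for v
    using that bij_betwE[OF g] bij_betwE[OF h] by (auto simp: f_def I_def J_def)
  ultimately show ?L by blast
qed

theorem theorem7:
  fixes S :: "'a signed_graph" and m n :: nat
  assumes "signed_graph S"
    and "complete_bipartite 1 (m + n) (graph.truncate S)"
    and "card (edges_of_sign S Pos) = m"
    and "card (edges_of_sign S Neg) = n"
  shows "parity_signed_graph S \<longleftrightarrow> n = m \<or> n = m + 2 \<or> n = m + 1"
proof -
  obtain A B where AB: "finite B" "card A = 1" "card B = m + n" "A \<inter> B = {}"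
    "verts S = A \<union> B" "edges S = {{a, b} | a b. a \<in> A \<and> b \<in> B}"
    using assms(2) by (auto simp: complete_bipartite_def graph.truncate_def)
  obtain c where c: "A = {c}" using AB(2) by (auto simp: card_1_singleton_iff)
  have cB: "c \<notin> B" and V: "verts S = insert c B" and E: "edges S = (\<lambda>v. {c, v}) ` B"
    using AB c by auto
  have N: "finite (verts S)" "card (verts S) = m + n + 1"
    using AB(1,3) cB V by auto
  define L where "L = {v \<in> B. signature S {c, v} = Pos}"
  define P where "P = insert c L"
  have "edges_of_sign S Pos = (\<lambda>v. {c, v}) ` L"
    by (auto simp: edges_of_sign_def E L_def)
  moreover have "inj_on (\<lambda>v. {c, v}) L"
    by (auto simp: inj_on_def doubleton_eq_iff)
  ultimately have "card L = m"
    using assms(3) card_image by metis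
  then have cardP: "card P = m + 1"
    using AB(1) cB by (simp add: P_def L_def)
  have "parity_labelling S f \<longleftrightarrow> bij_betw f (verts S) {1..card (verts S)} \<and>
      (\<forall>v\<in>verts S. even (f v) = even (f c) \<longleftrightarrow> v \<in> P)" for f
  proof -
    have "signature S {c, v} = parity_signature f {c, v} \<longleftrightarrow>
        (even (f v) = even (f c) \<longleftrightarrow> v \<in> P)" if "v \<in> B" for v
      using that cB by (cases "signature S {c, v}") (auto simp: parity_signature_edge P_def L_def)
    moreover have "c \<in> P" by (simp add: P_def)
    ultimately show ?thesis
      by (simp add: parity_labelling_def E V)
  qed
  moreover have "c \<in> P" "c \<in> verts S" "P \<subseteq> verts S" by (auto simp: P_def L_def V)
  ultimately have "parity_signed_graph S \<longleftrightarrow>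
      (\<exists>f b. bij_betw f (verts S) {1..card (verts S)} \<and> (\<forall>v\<in>verts S. even (f v) = b \<longleftrightarrow> v \<in> P))"
    using assms(1) unfolding parity_signed_graph_def by (metis (no_types, lifting))
  also have "\<dots> \<longleftrightarrow> m + 1 = (m + n + 1) div 2 \<or> m + 1 = (m + n + 2) div 2"
    using parity_class_labelling_iff[OF N(1) \<open>P \<subseteq> verts S\<close>] unfolding N(2) cardP by simp
  also have "\<dots> \<longleftrightarrow> n = m \<or> n = m + 2 \<or> n = m + 1"
    by presburger
  finally show ?thesis .
qed

end
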